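(* Let $n\ge1$ and let $\tau^{(n)}$ be as defined in the context. If $\tau^{(n)}(v_1,\dots,v_n)=(t_1,\dots,t_n)$, then $$v_n=\Bigl(2^{n-1}t_n-\sum_{j=1}^{n-1}2^{j-1}t_j\Bigr)\bmod 3.$$
   Context: Define maps $\tau^{(n)}:\{0,1,2\}^n\to\{0,1,2\}^n$ recursively: $\tau^{(1)}$ is the identity, and for $n\ge2$, $\tau^{(n)}(v_1,\dots,v_n)=\bigl(v_1,\ \tau^{(n-1)}(2(v_1+v_2)\bmod 3,\dots,2(v_1+v_n)\bmod 3)\bigr)$. *)

theory Defs
  imports Main
begin

text \<open>A vector in \<open>{0,1,2}\<^sup>n\<close> is an integer list of length \<open>n\<close> with entries in \<open>{0,1,2}\<close>; the
  length of the argument plays the role of the index \<open>n\<close> of \<open>\<tau>\<^bsup>(n)\<^esup>\<close>. The empty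
  list is a dummy case. The entry \<open>v\<^sub>i\<close> is \<open>vs ! (i - 1)\<close>.\<close>

function tau :: "int list \<Rightarrow> int list" where
  "tau [] = []"
| "tau [v] = [v]"
| "tau (v # w # vs) = v # tau (map (\<lambda>x. (2 * (v + x)) mod 3) (w # vs))"
  by pat_completeness auto
termination by (relation "measure length") auto

lemma length_tau [simp]: "length (tau vs) = length vs"
  by (induction vs rule: tau.induct) auto

lemma set_tau_subset: "set vs \<subseteq> {0, 1, 2} \<Longrightarrow> set (tau vs) \<subseteq> {0, 1, 2}"
proof (induction vs rule: tau.induct)
  case (3 v w vs)
  have mod3: "a mod 3 \<in> {0, 1, 2}" for a :: int
    by (simp, presburger)
  have "set (map (\<lambda>x. (2 * (v + x)) mod 3) (w # vs)) \<subseteq> {0, 1, 2}"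
    using mod3 by (simp only: set_map) blast
  then have "set (tau (map (\<lambda>x. (2 * (v + x)) mod 3) (w # vs))) \<subseteq> {0, 1, 2}"
    by (rule 3)
  with "3.prems" show ?case by simp
qed simp_all

end

theory Submission
  imports Defs
begin

text \<open>Let \<open>x\<close> be the last entry and \<open>v\<close> the first. One unfolding of
  \<open>tau\<close> keeps \<open>v\<close> and replaces \<open>x\<close> by 2(v + x) mod 3. By
  induction this new last entry is congruent to the formula \<open>s\<close> for the shorter vector.
  Since 2 is its own inverse mod 3, x is congruent to 2s - v, which is the formula for the full
  vector.\<close>

text \<open>Stated as a congruence, so that the induction needs no bound on the entries;
  \<open>last\<close> spares tracking an index that shifts as the list shrinks.\<close>

lemma last_mod_3_tau:
  assumes "vs \<noteq> []"
  shows "last vs mod 3 =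
    (2 ^ (length vs - 1) * last (tau vs) - (\<Sum>j<length vs - 1. 2 ^ j * tau vs ! j)) mod 3"
  using assms
proof (induction vs rule: tau.induct)
  case (3 v w vs)
  define us where "us = map (\<lambda>x. (2 * (v + x)) mod 3) (w # vs)"
  define x where "x = last (w # vs)"
  define s where "s = 2 ^ length vs * last (tau us) - (\<Sum>j<length vs. 2 ^ j * tau us ! j)"
  have us: "us \<noteq> []" "length us = Suc (length vs)"
    by (simp_all add: us_def)
  have tau_eq: "tau (v # w # vs) = v # tau us"
    by (simp only: tau.simps us_def)
  have ne: "tau us \<noteq> []"
    using us by (metis length_tau length_0_conv)
  have "last us = (2 * (v + x)) mod 3"
    unfolding x_def us_def by (rule last_map) simp
  then have IH: "(2 * (v + x)) mod 3 mod 3 = s mod 3"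
    using "3.IH"[folded us_def, OF us(1)] us(2) by (simp add: s_def)
  \<comment> \<open>Prepending \<open>v\<close> raises each exponent in \<open>s\<close> by one,
    hence the factor 2; the new term j = 0 contributes -v.\<close>
  have "2 ^ (length (v # w # vs) - 1) * last (tau (v # w # vs))
      - (\<Sum>j<length (v # w # vs) - 1. 2 ^ j * tau (v # w # vs) ! j) = 2 * s - v"
    unfolding tau_eq using ne
    by (simp add: s_def sum.lessThan_Suc_shift sum_distrib_left mult.assoc right_diff_distrib
        del: sum.lessThan_Suc)
  moreover have "x mod 3 = (2 * s - v) mod 3"
  proof -
    obtain k where "2 * (v + x) - s = 3 * k"
      using IH by (auto simp: mod_eq_dvd_iff)
    \<comment> \<open>Doubling gives 4(v + x) - 2s = 6k; subtracting 3(v + x) leaves the left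
      side.\<close>
    then have "x - (2 * s - v) = 3 * (2 * k - v - x)"
      by (simp add: algebra_simps)
    then show ?thesis
      unfolding mod_eq_dvd_iff by (rule dvdI)
  qed
  moreover have "last (v # w # vs) = x"
    by (simp add: x_def)
  ultimately show ?case
    by (simp only:)
qed simp_all

theorem theorem6:
  fixes n :: nat and vs ts :: "int list"
  assumes "n \<ge> 1"
    and "length vs = n" and "set vs \<subseteq> {0, 1, 2}"
    and "tau vs = ts"
  shows "vs ! (n - 1) =
    (2 ^ (n - 1) * ts ! (n - 1) - (\<Sum>j = 1..n - 1. 2 ^ (j - 1) * ts ! (j - 1))) mod 3"
proof -
  have ne: "vs \<noteq> []" "ts \<noteq> []" and len: "length ts = n"
    using assms length_tau[of vs] by auto
  \<comment> \<open>The range of the entries turns the congruence into an equality.\<close>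
  have "vs ! (n - 1) \<in> {0, 1, 2}"
    using assms by (intro subsetD[OF assms(3)] nth_mem) simp
  then have "vs ! (n - 1) = last vs mod 3"
    using ne assms(2) by (auto simp: last_conv_nth)
  moreover have "(\<Sum>j = 1..n - 1. 2 ^ (j - 1) * ts ! (j - 1)) = (\<Sum>j<n - 1. 2 ^ j * ts ! j)"
    by (rule sum.reindex_bij_witness[of _ Suc "\<lambda>j. j - 1"]) auto
  ultimately show ?thesis
    using last_mod_3_tau[OF ne(1)] ne len assms by (simp add: last_conv_nth)
qed

end
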